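(* Let $F$ be a field and let $\omega$ be a generic simplicial $3$-cocycle with values in $F$ on the simplex with vertices $1,\dots,7$. Consider the five-dimensional Pachner move 3--4, whose left-hand side is the cluster $M_{\mathrm{l}}$ of the three 5-simplices $123456$, $123457$, $123467$, and whose right-hand side is the cluster $M_{\mathrm{r}}$ of the four 5-simplices $123567$, $124567$, $134567$, $234567$; the two clusters have the same boundary $\partial M$. Define permitted colorings of each 5-simplex $v$ to be either the V-colorings of $\partial v$ or the F-colorings of $\partial v$, constructed from $\omega$. Then, for either of these definitions, the heptagon relation holds: the set $R_{\partial M}$ of permitted colorings of $\partial M$ obtained from $M_{\mathrm{l}}$ coincides with the set $R_{\partial M}$ of permitted colorings of $\partial M$ obtained from $M_{\mathrm{r}}$.
   Context: **Cocycles.** A 3-cocycle $\omega$ assigns to each tetrahedron $ijkl$ an element $\omega_{ijkl}\in F$, alternating under change of orientation, with $\omega_{jklm}-\omega_{iklm}+\omega_{ijlm}-\omega_{ijkm}+\omega_{ijkl}=0$ for every 4-simplex $ijklm$. "Generic" means here that $\omega_{ijkl}\neq 0$ for all tetrahedra $ijkl$. **Colorings.** A coloring of a complex assigns to each 4-simplex $u$ (pentachoron) a color in $F^3$; the color changes sign when the orientation of $u$ changes. Below, $x_u\in F^3$ is the color of $u$ with respect to the orientation given by the increasing order of its vertices. **Triangle vectors and V-colorings.** For each oriented triangle $s$ (orientation given by increasing order of vertices) the triangle vector $\mathsf e_s$ is the coloring whose component on $u$ is zero unless $u\supset s$, and for $u=12345$ is the row of the table below. For any $u=ijklm$ with $i<j<k<l<m$,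 substitute $1\mapsto i,\dots,5\mapsto m$. $$\begin{array}{c|ccc} s & & \mathsf e_s|_{12345} & \\ \hline 123 & 0 & \omega_{1345} & \omega_{1235}-\omega_{1234}\\ 124 & 0 & 0 & -\omega_{1235}\\ 125 & 0 & -\omega_{1345} & \omega_{1234}\\ 134 & \omega_{2345} & -\omega_{1235} & \omega_{1235}\\ 135 & -\omega_{2345} & \omega_{1345}+\omega_{1235} & -\omega_{1234}\\ 145 & \omega_{2345} & -\omega_{1235} & 0\\ 234 & -\omega_{1345} & 0 & -\omega_{1235}\\ 235 & \omega_{1345} & -\omega_{1345} & \omega_{1234}\\ 245 & -\omega_{1345} & 0 & 0\\ 345 & \omega_{1345}-\omega_{2345} & \omega_{1235} & 0 \end{array}$$ V-colorings of a complex are the elements of the linear span of the triangle vectors $\mathsf e_s$ over all its triangles $s$. **Triangle functionals and F-colorings.** Let $K$ be a triangulated closed oriented 4-manifold with ordered vertices. For each triangle $s$ the triangle functional $\mathsf f_s$ is the linear form on colorings $\mathsf f_s(x)=\sum_{u\supset s}\sigma_u\,\mathsf f_s|_u\cdot x_u$, where $\sigma_u=+1$ if the orientation of $u$ in $K$ coincides with the one given by the increasing order of its vertices, $\sigma_u=-1$ otherwise, $\cdot$ is the standard pairing of triples, and $\mathsf f_s|_u$ for $u=12345$ is the row of the table below. For $u=ijklm$, $i<j<k<l<m$, substitute $1\mapsto i,\dots,5\mapsto m$. $$\begin{array}{c|ccc} s & & \mathsf f_s|_{12345} & \\ \hline 123 & 0 & 0 & \frac{1}{\omega_{1234}\omega_{1235}}\\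 124 & \frac{1}{\omega_{1245}\omega_{1345}} & -\frac{\omega_{1345}-\omega_{2345}}{\omega_{1235}\omega_{1245}\omega_{1345}} & -\frac{\omega_{1245}+\omega_{1234}}{\omega_{1234}\omega_{1235}\omega_{1245}}\\ 125 & -\frac{1}{\omega_{1245}\omega_{1345}} & \frac{\omega_{1345}-\omega_{2345}}{\omega_{1235}\omega_{1245}\omega_{1345}} & \frac{1}{\omega_{1235}\omega_{1245}}\\ 134 & 0 & \frac{1}{\omega_{1235}\omega_{1345}} & \frac{1}{\omega_{1234}\omega_{1235}}\\ 135 & 0 & -\frac{1}{\omega_{1235}\omega_{1345}} & 0\\ 145 & \frac{1}{\omega_{1245}\omega_{1345}} & \frac{\omega_{1235}-\omega_{1234}}{\omega_{1235}\omega_{1245}\omega_{1345}} & -\frac{1}{\omega_{1235}\omega_{1245}}\\ 234 & -\frac{1}{\omega_{1345}\omega_{2345}} & -\frac{1}{\omega_{1235}\omega_{1345}} & -\frac{1}{\omega_{1234}\omega_{1235}}\\ 235 & \frac{1}{\omega_{1345}\omega_{2345}} & \frac{1}{\omega_{1235}\omega_{1345}} & 0\\ 245 & -\frac{\omega_{2345}+\omega_{1245}}{\omega_{1245}\omega_{1345}\omega_{2345}} & -\frac{\omega_{1235}-\omega_{1234}}{\omega_{1235}\omega_{1245}\omega_{1345}} & \frac{1}{\omega_{1235}\omega_{1245}}\\ 345 & \frac{1}{\omega_{1345}\omega_{2345}} & 0 & 0 \end{array}$$ F-colorings of $K$ are the colorings on which all $\mathsf f_s$ vanish. **Permitted colorings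 of a cluster.** For a 5-simplex $v$, $\partial v$ is its boundary (six pentachora), with an orientation as boundary of $v$. A permitted coloring of a cluster $M$ of 5-simplices is a coloring of all 4-simplices of $M$ (boundary and inner) whose restriction to (the boundary of) every 5-simplex of $M$ is permitted. A permitted coloring of $\partial M$ is the restriction to the 4-simplices of $\partial M$ of a permitted coloring of $M$; $R_{\partial M}$ denotes the set of these. *)

theory Defs
  imports
    "HOL-Analysis.Cartesian_Space"
    "HOL-Combinatorics.Permutations"
    "HOL-Library.Function_Algebras"
begin

section \<open>Generic simplicial 3-cocycles\<close>

text \<open>Simplices are finite sets of vertices, and vertices are natural numbers with their usual
  order. A 3-cochain takes its values on ordered quadruples of vertices; only quadruples of
  distinct vertices matter.\<close>

type_synonym 'a cochain3 = "nat \<Rightarrow> nat \<Rightarrow> nat \<Rightarrow> nat \<Rightarrow> 'a"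

definition alternating3 :: "nat set \<Rightarrow> 'a::field cochain3 \<Rightarrow> bool" where
  "alternating3 V \<omega> \<longleftrightarrow>
     (\<forall>i\<in>V. \<forall>j\<in>V. \<forall>k\<in>V. \<forall>l\<in>V. distinct [i, j, k, l] \<longrightarrow>
        (\<forall>p. p permutes {i, j, k, l} \<longrightarrow>
           \<omega> (p i) (p j) (p k) (p l) = of_int (sign p) * \<omega> i j k l))"

definition cocycle3 :: "nat set \<Rightarrow> 'a::field cochain3 \<Rightarrow> bool" where
  "cocycle3 V \<omega> \<longleftrightarrow> alternating3 V \<omega> \<and>
     (\<forall>i\<in>V. \<forall>j\<in>V. \<forall>k\<in>V. \<forall>l\<in>V. \<forall>m\<in>V. distinct [i, j, k, l, m] \<longrightarrow>
        \<omega> j k l m - \<omega> i k l m + \<omega> i j l m - \<omega> i j k m + \<omega> i j k l = 0)"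

definition generic3 :: "nat set \<Rightarrow> 'a::field cochain3 \<Rightarrow> bool" where
  "generic3 V \<omega> \<longleftrightarrow>
     (\<forall>i\<in>V. \<forall>j\<in>V. \<forall>k\<in>V. \<forall>l\<in>V. distinct [i, j, k, l] \<longrightarrow> \<omega> i j k l \<noteq> 0)"


section \<open>Colorings\<close>

text \<open>A complex is given by the set of its 4-simplices. A coloring of the complex \<open>K\<close> is a function
  on simplices that vanishes outside \<open>K\<close>, so that the colorings of \<open>K\<close> form a vector space.
  The value \<open>x u\<close> is the color of \<open>u\<close> with respect to the increasing order of its vertices; the
  color for the opposite orientation is \<open>- x u\<close> and need not be stored.\<close>

type_synonym 'a coloring = "nat set \<Rightarrow> 'a ^ 3"

definition scale_coloring :: "'a::field \<Rightarrow> 'a coloring \<Rightarrow> 'a coloring" where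
  "scale_coloring c x = (\<lambda>u. c *s x u)"

interpretation coloring: vector_space scale_coloring
  by unfold_locales
    (auto simp: scale_coloring_def fun_eq_iff vec_eq_iff algebra_simps)

definition colorings :: "nat set set \<Rightarrow> 'a::field coloring set" where
  "colorings K = {x. \<forall>u. u \<notin> K \<longrightarrow> x u = 0}"

definition restrict_coloring :: "'a::field coloring \<Rightarrow> nat set set \<Rightarrow> 'a coloring" where
  "restrict_coloring x K = (\<lambda>u. if u \<in> K then x u else 0)"

definition triangles :: "nat set set \<Rightarrow> nat set set" where
  "triangles K = {s. card s = 3 \<and> (\<exists>u\<in>K. s \<subseteq> u)}"


section \<open>V-colorings\<close>

definition triangle_vector_row :: "'a::field cochain3 \<Rightarrow> nat list \<Rightarrow> nat set \<Rightarrow> 'a ^ 3" where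
  "triangle_vector_row \<omega> u s = (case u of
     [i, j, k, l, m] \<Rightarrow>
       (let \<omega>1234 = \<omega> i j k l; \<omega>1235 = \<omega> i j k m; \<omega>1345 = \<omega> i k l m; \<omega>2345 = \<omega> j k l m in
        if s = {i, j, k} then vector [0, \<omega>1345, \<omega>1235 - \<omega>1234]
        else if s = {i, j, l} then vector [0, 0, - \<omega>1235]
        else if s = {i, j, m} then vector [0, - \<omega>1345, \<omega>1234]
        else if s = {i, k, l} then vector [\<omega>2345, - \<omega>1235, \<omega>1235]
        else if s = {i, k, m} then vector [- \<omega>2345, \<omega>1345 + \<omega>1235, - \<omega>1234]
        else if s = {i, l, m} then vector [\<omega>2345, - \<omega>1235, 0]
        else if s = {j, k, l} then vector [- \<omega>1345, 0, - \<omega>1235]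
        else if s = {j, k, m} then vector [\<omega>1345, - \<omega>1345, \<omega>1234]
        else if s = {j, l, m} then vector [- \<omega>1345, 0, 0]
        else if s = {k, l, m} then vector [\<omega>1345 - \<omega>2345, \<omega>1235, 0]
        else 0)
   | _ \<Rightarrow> 0)"

definition triangle_vector :: "'a::field cochain3 \<Rightarrow> nat set set \<Rightarrow> nat set \<Rightarrow> 'a coloring" where
  "triangle_vector \<omega> K s =
     (\<lambda>u. if u \<in> K \<and> s \<subseteq> u then triangle_vector_row \<omega> (sorted_list_of_set u) s else 0)"

definition V_colorings :: "'a::field cochain3 \<Rightarrow> nat set set \<Rightarrow> 'a coloring set" where
  "V_colorings \<omega> K = coloring.span (triangle_vector \<omega> K ` triangles K)"


section \<open>F-colorings\<close>

definition triangle_functional_row :: "'a::field cochain3 \<Rightarrow> nat list \<Rightarrow> nat set \<Rightarrow> 'a ^ 3" where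
  "triangle_functional_row \<omega> u s = (case u of
     [i, j, k, l, m] \<Rightarrow>
       (let \<omega>1234 = \<omega> i j k l; \<omega>1235 = \<omega> i j k m; \<omega>1245 = \<omega> i j l m;
            \<omega>1345 = \<omega> i k l m; \<omega>2345 = \<omega> j k l m in
        if s = {i, j, k} then vector
          [0,
           0,
           1 / (\<omega>1234 * \<omega>1235)]
        else if s = {i, j, l} then vector
          [1 / (\<omega>1245 * \<omega>1345),
           - ((\<omega>1345 - \<omega>2345) / (\<omega>1235 * \<omega>1245 * \<omega>1345)),
           - ((\<omega>1245 + \<omega>1234) / (\<omega>1234 * \<omega>1235 * \<omega>1245))]
        else if s = {i, j, m} then vector
          [- (1 / (\<omega>1245 * \<omega>1345)),
           (\<omega>1345 - \<omega>2345) / (\<omega>1235 * \<omega>1245 * \<omega>1345),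
           1 / (\<omega>1235 * \<omega>1245)]
        else if s = {i, k, l} then vector
          [0,
           1 / (\<omega>1235 * \<omega>1345),
           1 / (\<omega>1234 * \<omega>1235)]
        else if s = {i, k, m} then vector
          [0,
           - (1 / (\<omega>1235 * \<omega>1345)),
           0]
        else if s = {i, l, m} then vector
          [1 / (\<omega>1245 * \<omega>1345),
           (\<omega>1235 - \<omega>1234) / (\<omega>1235 * \<omega>1245 * \<omega>1345),
           - (1 / (\<omega>1235 * \<omega>1245))]
        else if s = {j, k, l} then vector
          [- (1 / (\<omega>1345 * \<omega>2345)),
           - (1 / (\<omega>1235 * \<omega>1345)),
           - (1 / (\<omega>1234 * \<omega>1235))]
        else if s = {j, k, m} then vector
          [1 / (\<omega>1345 * \<omega>2345),
           1 / (\<omega>1235 * \<omega>1345),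
           0]
        else if s = {j, l, m} then vector
          [- ((\<omega>2345 + \<omega>1245) / (\<omega>1245 * \<omega>1345 * \<omega>2345)),
           - ((\<omega>1235 - \<omega>1234) / (\<omega>1235 * \<omega>1245 * \<omega>1345)),
           1 / (\<omega>1235 * \<omega>1245)]
        else if s = {k, l, m} then vector
          [1 / (\<omega>1345 * \<omega>2345),
           0,
           0]
        else 0)
   | _ \<Rightarrow> 0)"

definition pairing :: "'a::field ^ 3 \<Rightarrow> 'a ^ 3 \<Rightarrow> 'a" where
  "pairing a b = (\<Sum>n\<in>UNIV. a $ n * b $ n)"

text \<open>An orientation of \<open>K\<close> is given by the signs \<open>\<sigma> u\<close> comparing it, on each 4-simplex \<open>u\<close>, with
  the orientation by the increasing order of the vertices.\<close>

definition triangle_functional ::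
    "'a::field cochain3 \<Rightarrow> nat set set \<Rightarrow> (nat set \<Rightarrow> int) \<Rightarrow> nat set \<Rightarrow> 'a coloring \<Rightarrow> 'a" where
  "triangle_functional \<omega> K \<sigma> s x =
     (\<Sum>u | u \<in> K \<and> s \<subseteq> u.
        of_int (\<sigma> u) * pairing (triangle_functional_row \<omega> (sorted_list_of_set u) s) (x u))"

definition F_colorings ::
    "'a::field cochain3 \<Rightarrow> nat set set \<Rightarrow> (nat set \<Rightarrow> int) \<Rightarrow> 'a coloring set" where
  "F_colorings \<omega> K \<sigma> =
     {x \<in> colorings K. \<forall>s\<in>triangles K. triangle_functional \<omega> K \<sigma> s x = 0}"


section \<open>Permitted colorings of 5-simplices and their clusters\<close>

definition facets :: "nat set \<Rightarrow> nat set set" where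
  "facets v = {v - {a} |a. a \<in> v}"

text \<open>The facet of \<open>v\<close> opposite to its \<open>n\<close>-th vertex (counting from 0, in increasing order) has
  incidence number \<open>(-1) ^ n\<close> with \<open>v\<close>. Here \<open>v\<close> is oriented by the increasing order of its
  vertices; the opposite choice changes all signs at once, hence the same F-colorings.\<close>

definition boundary_sign :: "nat set \<Rightarrow> nat set \<Rightarrow> int" where
  "boundary_sign v u = (-1) ^ card {b \<in> v. \<forall>a \<in> v - u. b < a}"

definition V_permitted :: "'a::field cochain3 \<Rightarrow> nat set \<Rightarrow> 'a coloring set" where
  "V_permitted \<omega> v = V_colorings \<omega> (facets v)"

definition F_permitted :: "'a::field cochain3 \<Rightarrow> nat set \<Rightarrow> 'a coloring set" where
  "F_permitted \<omega> v = F_colorings \<omega> (facets v) (boundary_sign v)"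

text \<open>A cluster is given by the set of its 5-simplices.\<close>

definition cluster_simplices4 :: "nat set set \<Rightarrow> nat set set" where
  "cluster_simplices4 M = (\<Union>v\<in>M. facets v)"

definition cluster_boundary :: "nat set set \<Rightarrow> nat set set" where
  "cluster_boundary M = {u. \<exists>!v. v \<in> M \<and> u \<in> facets v}"

definition permitted_colorings ::
    "(nat set \<Rightarrow> 'a::field coloring set) \<Rightarrow> nat set set \<Rightarrow> 'a coloring set" where
  "permitted_colorings P M =
     {x \<in> colorings (cluster_simplices4 M). \<forall>v\<in>M. restrict_coloring x (facets v) \<in> P v}"

definition permitted_boundary_colorings ::
    "(nat set \<Rightarrow> 'a::field coloring set) \<Rightarrow> nat set set \<Rightarrow> 'a coloring set" where
  "permitted_boundary_colorings P M =
     (\<lambda>x. restrict_coloring x (cluster_boundary M)) ` permitted_colorings P M"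

definition pachner34_left :: "nat set set" where
  "pachner34_left = {{1,2,3,4,5,6}, {1,2,3,4,5,7}, {1,2,3,4,6,7}}"

definition pachner34_right :: "nat set set" where
  "pachner34_right = {{1,2,3,5,6,7}, {1,2,4,5,6,7}, {1,3,4,5,6,7}, {2,3,4,5,6,7}}"

end

theory Submission
  imports Defs
begin

text \<open>Write \<open>\<phi> = \<delta>a\<close> for a 2-cochain \<open>a\<close>. The combination of triangle vectors with coefficients \<open>a\<close> has
  on each 4-simplex \<open>u\<close> a component consisting of \<open>2 \<times> 2\<close> minors of \<open>(\<omega>, \<phi>)\<close>, and two cocycles on \<open>u\<close>
  give the same color exactly when they differ by a multiple of \<open>\<omega>\<close>. For \<open>s = u - {b, c}\<close> the
  functional \<open>f\<^sub>s\<close> on this component is, up to sign, the difference of \<open>\<phi> / \<omega>\<close> on the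
  tetrahedra \<open>u - {c}\<close> and \<open>u - {b}\<close>.

  So a coloring is a family of cocycles \<open>\<phi>\<^sub>u\<close> modulo \<open>\<omega>\<close>. The F-equations on a 5-simplex say that
  the jumps of \<open>\<phi>\<^sub>u / \<omega>\<close> across tetrahedra form an additive cocycle, hence can be removed by
  adding multiples of \<open>\<omega>\<close>; thus F-colorings and V-colorings of a 5-simplex coincide. In the same way the
  cocycles on the 5-simplices of a cluster can be glued to one cocycle. The cone over a common
  vertex of the cluster (1 on the left, 7 on the right) makes it a coboundary \<open>\<delta>a\<close> with \<open>a\<close> defined on
  the whole 6-simplex, so both sides yield the boundary restrictions of the same set of colorings.\<close>

section \<open>Finite vertex sets and their increasing enumerations\<close>

lemma sorted_list_of_set_4:
  assumes "(i::nat) < j" "j < k" "k < l"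
  shows "sorted_list_of_set {i, j, k, l} = [i, j, k, l]"
  using assms sorted_list_of_set.idem_if_sorted_distinct[of "[i, j, k, l]"] by simp

lemma sorted_list_of_set_5:
  assumes "(i::nat) < j" "j < k" "k < l" "l < m"
  shows "sorted_list_of_set {i, j, k, l, m} = [i, j, k, l, m]"
  using assms sorted_list_of_set.idem_if_sorted_distinct[of "[i, j, k, l, m]"] by simp

lemma card_3_sorted:
  assumes "card (s :: nat set) = 3"
  obtains i j k where "s = {i, j, k}" "i < j" "j < k"
proof -
  define xs where "xs = sorted_list_of_set s"
  have fin: "finite s" using assms by (metis card.infinite zero_neq_numeral)
  have "length xs = 3" "sorted_wrt (<) xs" "set xs = s"
    using assms fin by (auto simp: xs_def)
  then show ?thesis
    by (auto simp: numeral_eq_Suc length_Suc_conv intro!: that)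
qed

lemma card_4_sorted:
  assumes "card (q :: nat set) = 4"
  obtains i j k l where "q = {i, j, k, l}" "i < j" "j < k" "k < l"
proof -
  define xs where "xs = sorted_list_of_set q"
  have fin: "finite q" using assms by (metis card.infinite zero_neq_numeral)
  have "length xs = 4" "sorted_wrt (<) xs" "set xs = q"
    using assms fin by (auto simp: xs_def)
  then show ?thesis
    by (auto simp: numeral_eq_Suc length_Suc_conv intro!: that)
qed

lemma card_5_sorted:
  assumes "card (u :: nat set) = 5"
  obtains i j k l m where "u = {i, j, k, l, m}" "i < j" "j < k" "k < l" "l < m"
proof -
  define xs where "xs = sorted_list_of_set u"
  have fin: "finite u" using assms by (metis card.infinite zero_neq_numeral)
  have "length xs = 5" "sorted_wrt (<) xs" "set xs = u"
    using assms fin by (auto simp: xs_def)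
  then show ?thesis
    by (auto simp: numeral_eq_Suc length_Suc_conv intro!: that)
qed

text \<open>Decides the comparisons \<open>s = {i, j, k}\<close> in the case lists of the two
  tables, where triangles are written in increasing order.\<close>

lemma sorted_triple_eq_iff:
  assumes "(i::nat) < j" "j < k" "a < b" "b < c"
  shows "{i, j, k} = {a, b, c} \<longleftrightarrow> i = a \<and> j = b \<and> k = c"
proof
  assume eq: "{i, j, k} = {a, b, c}"
  have "sorted_list_of_set {i, j, k} = [i, j, k]" "sorted_list_of_set {a, b, c} = [a, b, c]"
    using assms sorted_list_of_set.idem_if_sorted_distinct[of "[i, j, k]"]
      sorted_list_of_set.idem_if_sorted_distinct[of "[a, b, c]"] by simp_all
  then have "[i, j, k] = [a, b, c]" by (simp only: eq)
  then show "i = a \<and> j = b \<and> k = c" by simp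
qed simp

lemma face_of_5:
  assumes "(i::nat) < j" "j < k" "k < l" "l < m" "q \<subseteq> {i, j, k, l, m}" "card q = 4"
  shows "q \<in> {{j, k, l, m}, {i, k, l, m}, {i, j, l, m}, {i, j, k, m}, {i, j, k, l}}"
proof -
  let ?u = "{i, j, k, l, m}"
  have "card ?u = 5" using assms(1-4) by simp
  then have "card (?u - q) = 1" using assms(5,6) by (simp add: card_Diff_subset finite_subset)
  then obtain x where x: "?u - q = {x}" by (rule card_1_singletonE)
  then have "q = ?u - {x}" "x \<in> ?u" using assms(5) by auto
  then show ?thesis using assms(1-4) by (auto simp: insert_Diff_if)
qed

lemma triangle_complement_of_5:
  assumes "card (u :: nat set) = 5" "s \<subseteq> u" "card s = 3"
  obtains b c where "s = u - {b, c}" "b \<in> u" "c \<in> u" "b < c"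
proof -
  have "finite u" using assms(1) by (metis card.infinite zero_neq_numeral)
  then have "card (u - s) = 2" using assms by (simp add: card_Diff_subset finite_subset)
  then obtain b c where bc: "u - s = {b, c}" "b \<noteq> c" by (auto simp: card_2_iff)
  then have "s = u - {b, c}" "b \<in> u" "c \<in> u" using assms(2) by auto
  moreover have "s = u - {c, b}" using calculation by auto
  ultimately show thesis using that[of b c] that[of c b] bc(2) by (cases "b < c") auto
qed

text \<open>Checking a table row by row means going through the ten pairs of omitted vertices. The
  triangle and the two tetrahedra are arguments of \<open>P\<close> so that each case speaks of
  explicit vertex sets.\<close>

lemma triangle_complement_cases:
  assumes less: "(i::nat) < j" "j < k" "k < l" "l < m"
    and bc: "b \<in> {i, j, k, l, m}" "c \<in> {i, j, k, l, m}" "b < c"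
    and P: "P i j {k, l, m} {j, k, l, m} {i, k, l, m}" "P i k {j, l, m} {j, k, l, m} {i, j, l, m}"
      "P i l {j, k, m} {j, k, l, m} {i, j, k, m}" "P i m {j, k, l} {j, k, l, m} {i, j, k, l}"
      "P j k {i, l, m} {i, k, l, m} {i, j, l, m}" "P j l {i, k, m} {i, k, l, m} {i, j, k, m}"
      "P j m {i, k, l} {i, k, l, m} {i, j, k, l}" "P k l {i, j, m} {i, j, l, m} {i, j, k, m}"
      "P k m {i, j, l} {i, j, l, m} {i, j, k, l}" "P l m {i, j, k} {i, j, k, m} {i, j, k, l}"
  shows "P b c ({i, j, k, l, m} - {b, c}) ({i, j, k, l, m} - {b}) ({i, j, k, l, m} - {c})"
proof -
  have less': "i < k" "i < l" "i < m" "j < l" "j < m" "k < m" using less by simp_all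
  have "(b, c) \<in> {(i, j), (i, k), (i, l), (i, m), (j, k), (j, l), (j, m), (k, l), (k, m), (l, m)}"
    using bc less less' by (elim insertE emptyE) simp_all
  then show ?thesis using less less' P
    by (elim insertE emptyE) (simp_all add: insert_Diff_if)
qed

section \<open>Cochains as functions on simplices\<close>

text \<open>Below, a simplicial cochain is a function on sets of vertices, giving the value for the
  increasing order of the vertices.\<close>

definition on_tetrahedra :: "'a::field cochain3 \<Rightarrow> nat set \<Rightarrow> 'a" where
  "on_tetrahedra \<omega> q = (case sorted_list_of_set q of [i, j, k, l] \<Rightarrow> \<omega> i j k l | _ \<Rightarrow> 0)"

lemma on_tetrahedra_eq:
  "i < j \<Longrightarrow> j < k \<Longrightarrow> k < l \<Longrightarrow> on_tetrahedra \<omega> {i, j, k, l} = \<omega> i j k l"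
  by (simp add: on_tetrahedra_def sorted_list_of_set_4)

definition closed3 :: "nat set \<Rightarrow> (nat set \<Rightarrow> 'a::field) \<Rightarrow> bool" where
  "closed3 S \<phi> \<longleftrightarrow> (\<forall>i\<in>S. \<forall>j\<in>S. \<forall>k\<in>S. \<forall>l\<in>S. \<forall>m\<in>S. i < j \<and> j < k \<and> k < l \<and> l < m \<longrightarrow>
     \<phi> {j, k, l, m} - \<phi> {i, k, l, m} + \<phi> {i, j, l, m} - \<phi> {i, j, k, m} + \<phi> {i, j, k, l} = 0)"

lemma closed3D:
  assumes "closed3 S \<phi>" "{i, j, k, l, m} \<subseteq> S" "i < j" "j < k" "k < l" "l < m"
  shows "\<phi> {j, k, l, m} = \<phi> {i, k, l, m} - \<phi> {i, j, l, m} + \<phi> {i, j, k, m} - \<phi> {i, j, k, l}"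
proof -
  have "\<phi> {j, k, l, m} - \<phi> {i, k, l, m} + \<phi> {i, j, l, m} - \<phi> {i, j, k, m} + \<phi> {i, j, k, l} = 0"
    using assms by (auto simp: closed3_def)
  then show ?thesis by algebra
qed

lemma closed3_mono: "closed3 S \<phi> \<Longrightarrow> T \<subseteq> S \<Longrightarrow> closed3 T \<phi>"
  unfolding closed3_def by blast

lemma closed3_combination:
  assumes "closed3 S \<phi>" "closed3 S \<psi>"
  shows "closed3 S (\<lambda>q. a * \<phi> q + b * \<psi> q)"
  unfolding closed3_def
proof (intro ballI impI)
  fix i j k l m
  assume "i \<in> S" "j \<in> S" "k \<in> S" "l \<in> S" "m \<in> S"
    and "i < j \<and> j < k \<and> k < l \<and> l < m"
  then have "\<phi> {j, k, l, m} = \<phi> {i, k, l, m} - \<phi> {i, j, l, m} + \<phi> {i, j, k, m} - \<phi> {i, j, k, l}"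
    "\<psi> {j, k, l, m} = \<psi> {i, k, l, m} - \<psi> {i, j, l, m} + \<psi> {i, j, k, m} - \<psi> {i, j, k, l}"
    using closed3D[OF assms(1), of i j k l m] closed3D[OF assms(2), of i j k l m] by simp_all
  then show "a * \<phi> {j, k, l, m} + b * \<psi> {j, k, l, m} - (a * \<phi> {i, k, l, m} + b * \<psi> {i, k, l, m}) +
      (a * \<phi> {i, j, l, m} + b * \<psi> {i, j, l, m}) - (a * \<phi> {i, j, k, m} + b * \<psi> {i, j, k, m}) +
      (a * \<phi> {i, j, k, l} + b * \<psi> {i, j, k, l}) = 0"
    by algebra
qed

lemma closed3_add: "closed3 S \<phi> \<Longrightarrow> closed3 S \<psi> \<Longrightarrow> closed3 S (\<lambda>q. \<phi> q + \<psi> q)"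
  using closed3_combination[of S \<phi> \<psi> 1 1] by simp

lemma closed3_scale: "closed3 S \<phi> \<Longrightarrow> closed3 S (\<lambda>q. c * \<phi> q)"
  using closed3_combination[of S \<phi> \<phi> c 0] by simp

definition coboundary :: "(nat set \<Rightarrow> 'a::field) \<Rightarrow> nat set \<Rightarrow> 'a" where
  "coboundary a q = (case sorted_list_of_set q of
     [i, j, k, l] \<Rightarrow> a {j, k, l} - a {i, k, l} + a {i, j, l} - a {i, j, k} | _ \<Rightarrow> 0)"

lemma coboundary_eq:
  "i < j \<Longrightarrow> j < k \<Longrightarrow> k < l \<Longrightarrow>
     coboundary a {i, j, k, l} = a {j, k, l} - a {i, k, l} + a {i, j, l} - a {i, j, k}"
  by (simp add: coboundary_def sorted_list_of_set_4)

lemma closed3_coboundary: "closed3 S (coboundary a)"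
  by (auto simp: closed3_def coboundary_eq)

text \<open>The cone with apex \<open>p\<close> is a contracting homotopy: apply the cocycle
  condition to \<open>p\<close> together with the vertices of \<open>q\<close>. Since
  \<open>p\<close> is the smallest vertex, inserting it in front causes no sign.\<close>

lemma closed3_eq_coboundary_Min:
  assumes "closed3 S \<phi>" "p \<in> S" "\<And>x. x \<in> S \<Longrightarrow> p \<le> x" "q \<subseteq> S" "card q = 4"
  shows "\<phi> q = coboundary (\<lambda>t. if p \<in> t then 0 else \<phi> (insert p t)) q"
proof -
  obtain i j k l where q: "q = {i, j, k, l}" "i < j" "j < k" "k < l"
    using card_4_sorted[OF assms(5)] .
  show ?thesis
  proof (cases "i = p")
    case True
    then show ?thesis using q by (simp add: coboundary_eq)
  next
    case False
    then have "p < i" using assms(3)[of i] assms(4) q by auto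
    then have "p < j" "p < k" "p < l" using q by auto
    then show ?thesis
      using closed3D[OF assms(1), of p i j k l] q assms(2,4) \<open>p < i\<close>
      by (simp add: coboundary_eq)
  qed
qed

text \<open>The same cone with the apex in the last place. Moving \<open>p\<close> past the three
  vertices of \<open>t\<close> accounts for the minus sign.\<close>

lemma closed3_eq_coboundary_Max:
  assumes "closed3 S \<phi>" "p \<in> S" "\<And>x. x \<in> S \<Longrightarrow> x \<le> p" "q \<subseteq> S" "card q = 4"
  shows "\<phi> q = coboundary (\<lambda>t. if p \<in> t then 0 else - \<phi> (insert p t)) q"
proof -
  obtain i j k l where q: "q = {i, j, k, l}" "i < j" "j < k" "k < l"
    using card_4_sorted[OF assms(5)] .
  have ins: "insert p {x, y, z} = {x, y, z, p}" for x y z by blast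
  show ?thesis
  proof (cases "l = p")
    case True
    then show ?thesis using q by (simp add: coboundary_eq ins)
  next
    case False
    then have "l < p" using assms(3)[of l] assms(4) q by auto
    then have "i < p" "j < p" "k < p" using q by auto
    then show ?thesis
      using closed3D[OF assms(1), of i j k l p] q assms(2,4) \<open>l < p\<close>
      by (simp add: coboundary_eq ins)
  qed
qed


section \<open>Colors from 3-cocycles\<close>

text \<open>The minors belong to neighbours in the list 2345, 1345, 1235, 1234. For cocycles the
  value on the remaining tetrahedron 1245 is fixed by the cocycle condition.\<close>

definition color :: "(nat set \<Rightarrow> 'a::field) \<Rightarrow> (nat set \<Rightarrow> 'a) \<Rightarrow> nat set \<Rightarrow> 'a ^ 3" where
  "color w \<phi> u = (case sorted_list_of_set u of
     [i, j, k, l, m] \<Rightarrow> vector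
       [w {i, k, l, m} * \<phi> {j, k, l, m} - w {j, k, l, m} * \<phi> {i, k, l, m},
        w {i, j, k, m} * \<phi> {i, k, l, m} - w {i, k, l, m} * \<phi> {i, j, k, m},
        w {i, j, k, l} * \<phi> {i, j, k, m} - w {i, j, k, m} * \<phi> {i, j, k, l}]
   | _ \<Rightarrow> 0)"

lemma color_eq:
  assumes "i < j" "j < k" "k < l" "l < m"
  shows "color w \<phi> {i, j, k, l, m} = vector
       [w {i, k, l, m} * \<phi> {j, k, l, m} - w {j, k, l, m} * \<phi> {i, k, l, m},
        w {i, j, k, m} * \<phi> {i, k, l, m} - w {i, k, l, m} * \<phi> {i, j, k, m},
        w {i, j, k, l} * \<phi> {i, j, k, m} - w {i, j, k, m} * \<phi> {i, j, k, l}]"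
  using assms by (simp add: color_def sorted_list_of_set_5)

lemma color_cong:
  assumes "card u = 5" "\<And>q. q \<subseteq> u \<Longrightarrow> card q = 4 \<Longrightarrow> \<phi> q = \<psi> q"
  shows "color w \<phi> u = color w \<psi> u"
proof -
  obtain i j k l m where u: "u = {i, j, k, l, m}" "i < j" "j < k" "k < l" "l < m"
    using card_5_sorted[OF assms(1)] .
  have "\<phi> {i, j, k, l} = \<psi> {i, j, k, l}" "\<phi> {i, j, k, m} = \<psi> {i, j, k, m}"
    "\<phi> {i, k, l, m} = \<psi> {i, k, l, m}" "\<phi> {j, k, l, m} = \<psi> {j, k, l, m}"
    using u by (auto intro!: assms(2))
  then show ?thesis by (simp add: u color_eq)
qed

lemma color_add: "color w (\<lambda>q. \<phi> q + \<psi> q) u = color w \<phi> u + color w \<psi> u"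
  by (auto simp: color_def vec_eq_iff forall_3 algebra_simps split: list.split)

lemma color_scale: "color w (\<lambda>q. c * \<phi> q) u = c *s color w \<phi> u"
  by (auto simp: color_def vec_eq_iff forall_3 algebra_simps split: list.split)

text \<open>Minors of two equal rows vanish. By linearity, adding a multiple of \<open>w\<close> to
  a cocycle leaves its color unchanged.\<close>

lemma color_self: "color w w u = 0"
  by (auto simp: color_def vec_eq_iff forall_3 algebra_simps split: list.split)

text \<open>\<open>A\<close>, \<open>B\<close>, \<open>C\<close>, \<open>D\<close>, \<open>E\<close> and \<open>a\<close>, \<open>b\<close>, \<open>c\<close>, \<open>d\<close>, \<open>e\<close> stand for the values of \<open>\<omega>\<close> and \<open>\<phi>\<close> on the
  tetrahedra 1234, 1235, 1245, 1345, 2345. The rows of the table of triangle functionals are copied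
  literally, zeros included, so that the identities can be used for rewriting.\<close>

lemma pairing_identities:
  fixes A B C D E :: "'a::field"
  assumes nz: "A \<noteq> 0" "B \<noteq> 0" "C \<noteq> 0" "D \<noteq> 0" "E \<noteq> 0"
    and E: "E = D - C + B - A" and e: "e = d - c + b - a"
  shows "0 * (D * e - E * d) + 0 * (B * d - D * b) + 1 / (A * B) * (A * b - B * a) =
      b / B - a / A"
    "1 / (C * D) * (D * e - E * d) +
      - ((D - E) / (B * C * D)) * (B * d - D * b) + - ((C + A) / (A * B * C)) * (A * b - B * a) =
      a / A - c / C"
    "- (1 / (C * D)) * (D * e - E * d) +
      (D - E) / (B * C * D) * (B * d - D * b) + 1 / (B * C) * (A * b - B * a) =
      c / C - b / B"
    "0 * (D * e - E * d) + 1 / (B * D) * (B * d - D * b) + 1 / (A * B) * (A * b - B * a) =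
      d / D - a / A"
    "0 * (D * e - E * d) + - (1 / (B * D)) * (B * d - D * b) + 0 * (A * b - B * a) =
      b / B - d / D"
    "1 / (C * D) * (D * e - E * d) +
      (B - A) / (B * C * D) * (B * d - D * b) + - (1 / (B * C)) * (A * b - B * a) =
      d / D - c / C"
    "- (1 / (D * E)) * (D * e - E * d) +
      - (1 / (B * D)) * (B * d - D * b) + - (1 / (A * B)) * (A * b - B * a) =
      a / A - e / E"
    "1 / (D * E) * (D * e - E * d) + 1 / (B * D) * (B * d - D * b) + 0 * (A * b - B * a) =
      e / E - b / B"
    "- ((E + C) / (C * D * E)) * (D * e - E * d) +
      - ((B - A) / (B * C * D)) * (B * d - D * b) + 1 / (B * C) * (A * b - B * a) =
      c / C - e / E"
    "1 / (D * E) * (D * e - E * d) + 0 * (B * d - D * b) + 0 * (A * b - B * a) =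
      e / E - d / D"
proof -
  \<comment> \<open>The letters \<open>C\<close> and \<open>c\<close> do not occur in the minors, so
    eliminating them leaves identities between free variables, checked after clearing
    denominators.\<close>
  have C: "C = D - E + B - A" and c: "c = d - e + b - a" using E e by simp_all
  show "0 * (D * e - E * d) + 0 * (B * d - D * b) + 1 / (A * B) * (A * b - B * a) =
      b / B - a / A"
    using nz unfolding C c by (simp add: divide_simps; algebra)
  show "1 / (C * D) * (D * e - E * d) +
      - ((D - E) / (B * C * D)) * (B * d - D * b) + - ((C + A) / (A * B * C)) * (A * b - B * a) =
      a / A - c / C"
    using nz unfolding C c by (simp add: divide_simps; algebra)
  show "- (1 / (C * D)) * (D * e - E * d) +
      (D - E) / (B * C * D) * (B * d - D * b) + 1 / (B * C) * (A * b - B * a) =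
      c / C - b / B"
    using nz unfolding C c by (simp add: divide_simps; algebra)
  show "0 * (D * e - E * d) + 1 / (B * D) * (B * d - D * b) + 1 / (A * B) * (A * b - B * a) =
      d / D - a / A"
    using nz unfolding C c by (simp add: divide_simps; algebra)
  show "0 * (D * e - E * d) + - (1 / (B * D)) * (B * d - D * b) + 0 * (A * b - B * a) =
      b / B - d / D"
    using nz unfolding C c by (simp add: divide_simps; algebra)
  show "1 / (C * D) * (D * e - E * d) +
      (B - A) / (B * C * D) * (B * d - D * b) + - (1 / (B * C)) * (A * b - B * a) =
      d / D - c / C"
    using nz unfolding C c by (simp add: divide_simps; algebra)
  show "- (1 / (D * E)) * (D * e - E * d) +
      - (1 / (B * D)) * (B * d - D * b) + - (1 / (A * B)) * (A * b - B * a) =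
      a / A - e / E"
    using nz unfolding C c by (simp add: divide_simps; algebra)
  show "1 / (D * E) * (D * e - E * d) + 1 / (B * D) * (B * d - D * b) + 0 * (A * b - B * a) =
      e / E - b / B"
    using nz unfolding C c by (simp add: divide_simps; algebra)
  show "- ((E + C) / (C * D * E)) * (D * e - E * d) +
      - ((B - A) / (B * C * D)) * (B * d - D * b) + 1 / (B * C) * (A * b - B * a) =
      c / C - e / E"
    using nz unfolding C c by (simp add: divide_simps; algebra)
  show "1 / (D * E) * (D * e - E * d) + 0 * (B * d - D * b) + 0 * (A * b - B * a) =
      e / E - d / D"
    using nz unfolding C c by (simp add: divide_simps; algebra)
qed

lemma pairing_vector: "pairing (vector [a, b, c]) (vector [x, y, z]) = a * x + b * y + c * z"
  by (simp add: pairing_def sum_3)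

section \<open>Colors relative to a generic cocycle: kernel, image and the two tables\<close>

locale generic_cocycle =
  fixes S :: "nat set" and \<omega> :: "'a::field cochain3" and w :: "nat set \<Rightarrow> 'a"
  defines "w \<equiv> on_tetrahedra \<omega>"
  assumes cocycle: "cocycle3 S \<omega>" and generic: "generic3 S \<omega>"
begin

lemma w_eq: "i < j \<Longrightarrow> j < k \<Longrightarrow> k < l \<Longrightarrow> \<omega> i j k l = w {i, j, k, l}"
  by (simp add: w_def on_tetrahedra_eq)

lemma w_closed: "closed3 S w"
  unfolding closed3_def
proof (intro ballI impI)
  fix i j k l m
  assume S: "i \<in> S" "j \<in> S" "k \<in> S" "l \<in> S" "m \<in> S"
    and less: "i < j \<and> j < k \<and> k < l \<and> l < m"
  have "\<omega> j k l m - \<omega> i k l m + \<omega> i j l m - \<omega> i j k m + \<omega> i j k l = 0"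
    using cocycle S less unfolding cocycle3_def by simp
  then show "w {j, k, l, m} - w {i, k, l, m} + w {i, j, l, m} - w {i, j, k, m} + w {i, j, k, l} = 0"
    using less by (simp add: w_eq)
qed

lemma w_nonzero: "card q = 4 \<Longrightarrow> q \<subseteq> S \<Longrightarrow> w q \<noteq> 0"
proof -
  assume q: "card q = 4" "q \<subseteq> S"
  obtain i j k l where ijkl: "q = {i, j, k, l}" "i < j" "j < k" "k < l"
    using card_4_sorted[OF q(1)] .
  then have "\<omega> i j k l \<noteq> 0" using generic q(2) unfolding generic3_def by simp
  then show "w q \<noteq> 0" using ijkl by (simp add: w_eq)
qed

text \<open>All minors of \<open>w\<close> and the difference vanish. Since \<open>w\<close> is
  nonzero on tetrahedra, the factor \<open>c\<close> found on one tetrahedron passes along to the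
  others that enter \<open>color\<close>.\<close>

lemma color_eq_iff:
  assumes u: "card u = 5" "u \<subseteq> S" and closed: "closed3 u \<phi>" "closed3 u \<psi>"
    and eq: "color w \<phi> u = color w \<psi> u"
  obtains c where "\<And>q. q \<subseteq> u \<Longrightarrow> card q = 4 \<Longrightarrow> \<phi> q - \<psi> q = c * w q"
proof -
  obtain i j k l m where u': "u = {i, j, k, l, m}" and less: "i < j" "j < k" "k < l" "l < m"
    using card_5_sorted[OF u(1)] .
  let ?d = "\<lambda>q. \<phi> q - \<psi> q"
  define c where "c = ?d {i, k, l, m} / w {i, k, l, m}"
  have nz: "w {i, k, l, m} \<noteq> 0" "w {i, j, k, m} \<noteq> 0"
    using u u' less by (simp_all add: w_nonzero)
  have d: "?d {i, k, l, m} = c * w {i, k, l, m}"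
    using nz by (simp add: c_def)
  have proportional: "y' = c * y" if "x \<noteq> 0" "x * y' = y * x'" "x' = c * x" for x y x' y' :: 'a
    using that by auto
  have eq: "w {i, k, l, m} * ?d {j, k, l, m} = w {j, k, l, m} * ?d {i, k, l, m}"
    "w {i, k, l, m} * ?d {i, j, k, m} = w {i, j, k, m} * ?d {i, k, l, m}"
    "w {i, j, k, m} * ?d {i, j, k, l} = w {i, j, k, l} * ?d {i, j, k, m}"
    using eq less by (simp_all add: u' color_eq vec_eq_iff forall_3 algebra_simps)
  have e: "?d {j, k, l, m} = c * w {j, k, l, m}" by (rule proportional[OF nz(1) eq(1) d])
  have b: "?d {i, j, k, m} = c * w {i, j, k, m}" by (rule proportional[OF nz(1) eq(2) d])
  have a: "?d {i, j, k, l} = c * w {i, j, k, l}" by (rule proportional[OF nz(2) eq(3) b])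
  \<comment> \<open>This tetrahedron is not seen by \<open>color\<close>; the cocycle conditions for
    both cochains and for \<open>w\<close> supply it.\<close>
  have "?d {i, j, l, m} = c * w {i, j, l, m}"
    using a b d e closed3D[OF closed(1), unfolded u', OF subset_refl less]
      closed3D[OF closed(2), unfolded u', OF subset_refl less]
      closed3D[OF closed3_mono[OF w_closed u(2)], unfolded u', OF subset_refl less]
    by algebra
  then have "?d q = c * w q" if "q \<subseteq> u" "card q = 4" for q
    using face_of_5[OF less that[unfolded u']] a b d e by auto
  then show thesis using that by blast
qed

text \<open>Only the class modulo \<open>w\<close> matters, so the value on
  \<open>{i, j, k, m}\<close> may be taken to be 0. What remains is a triangular system with nonzero
  values of \<open>w\<close> as pivots.\<close>

lemma color_surj:
  assumes u: "card u = 5" "u \<subseteq> S"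
  obtains \<phi> where "closed3 u \<phi>" "color w \<phi> u = x"
proof -
  obtain i j k l m where u': "u = {i, j, k, l, m}" and less: "i < j" "j < k" "k < l" "l < m"
    using card_5_sorted[OF u(1)] .
  have nz: "w {i, k, l, m} \<noteq> 0" "w {i, j, k, m} \<noteq> 0"
    using u u' less by (simp_all add: w_nonzero)
  define d where "d = x $ 2 / w {i, j, k, m}"
  define e where "e = (x $ 1 + w {j, k, l, m} * d) / w {i, k, l, m}"
  define a where "a = - x $ 3 / w {i, j, k, m}"
  \<comment> \<open>The cases name a tetrahedron by its missing vertex. The value
    \<open>d - e - a\<close> is forced by the cocycle condition.\<close>
  define \<phi> where "\<phi> q = (if i \<notin> q then e else if j \<notin> q then d else if k \<notin> q then d - e - a
    else if l \<notin> q then 0 else a)" for q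
  have \<phi>: "\<phi> {j, k, l, m} = e" "\<phi> {i, k, l, m} = d" "\<phi> {i, j, l, m} = d - e - a"
      "\<phi> {i, j, k, m} = 0" "\<phi> {i, j, k, l} = a"
    using less by (auto simp: \<phi>_def)
  have "closed3 u \<phi>"
    unfolding closed3_def
  proof (intro ballI impI)
    fix i' j' k' l' m'
    assume "i' \<in> u" "j' \<in> u" "k' \<in> u" "l' \<in> u" "m' \<in> u"
      and less': "i' < j' \<and> j' < k' \<and> k' < l' \<and> l' < m'"
    \<comment> \<open>\<open>u\<close> contains only one increasing 5-tuple, so a single condition
      has to be checked.\<close>
    then have "{i', j', k', l', m'} \<subseteq> u" "card {i', j', k', l', m'} = 5" by auto
    moreover have "finite u" by (simp add: u')
    ultimately have "{i', j', k', l', m'} = u" using u(1) by (metis card_subset_eq)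
    then have "sorted_list_of_set {i', j', k', l', m'} = sorted_list_of_set {i, j, k, l, m}"
      by (simp only: u')
    then have "i' = i" "j' = j" "k' = k" "l' = l" "m' = m"
      using less less' by (simp_all add: sorted_list_of_set_5)
    then show "\<phi> {j', k', l', m'} - \<phi> {i', k', l', m'} + \<phi> {i', j', l', m'} - \<phi> {i', j', k', m'}
        + \<phi> {i', j', k', l'} = 0"
      by (simp add: \<phi>)
  qed
  moreover have "color w \<phi> u = x"
    using less nz by (simp add: u' color_eq \<phi> vec_eq_iff forall_3 a_def d_def e_def)
  ultimately show thesis by (rule that)
qed

text \<open>The coboundary of the indicator function of \<open>s\<close> takes the values 0, 1 and
  -1, so its minors with \<open>w\<close> are signed sums of values of \<open>w\<close>: the entries
  of the table. If \<open>s\<close> is not in \<open>u\<close>, it vanishes on all tetrahedra of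
  \<open>u\<close>.\<close>

lemma triangle_vector_row_eq_color:
  assumes u: "card u = 5" and s: "card s = 3"
  shows "(if s \<subseteq> u then triangle_vector_row \<omega> (sorted_list_of_set u) s else 0) =
    color w (coboundary (\<lambda>t. if t = s then 1 else 0)) u"
proof -
  obtain i j k l m where u': "u = {i, j, k, l, m}" and less: "i < j" "j < k" "k < l" "l < m"
    using card_5_sorted[OF u] .
  then have less': "i < k" "i < l" "i < m" "j < l" "j < m" "k < m" by simp_all
  note order = less less' less[THEN less_imp_neq] less'[THEN less_imp_neq]
    less[THEN less_imp_neq, symmetric] less'[THEN less_imp_neq, symmetric]
  show ?thesis
  proof (cases "s \<subseteq> u")
    case True
    obtain b c where bc: "s = {i, j, k, l, m} - {b, c}"
        "b \<in> {i, j, k, l, m}" "c \<in> {i, j, k, l, m}" "b < c"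
      using triangle_complement_of_5[OF u True s] unfolding u' .
    have "triangle_vector_row \<omega> [i, j, k, l, m] s =
        color w (coboundary (\<lambda>t. if t = s then 1 else 0)) {i, j, k, l, m}"
      unfolding bc(1)
      apply (rule triangle_complement_cases[OF less bc(2-4), where P = "\<lambda>b c s q q'.
          triangle_vector_row \<omega> [i, j, k, l, m] s =
          color w (coboundary (\<lambda>t. if t = s then 1 else 0)) {i, j, k, l, m}"])
               apply (simp_all only: order color_eq coboundary_eq triangle_vector_row_def w_eq
          list.case Let_def sorted_triple_eq_iff simp_thms if_True if_False)
               apply (simp_all add: add.commute)
      done
    then show ?thesis using True less by (simp add: u' sorted_list_of_set_5)
  next
    case False
    have "coboundary (\<lambda>t. if t = s then 1 else 0) q = (0 :: 'a)" if q: "q \<subseteq> u" "card q = 4" for q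
    proof -
      obtain a b c d where "q = {a, b, c, d}" "a < b" "b < c" "c < d"
        using card_4_sorted[OF q(2)] .
      then show ?thesis using False q(1) by (auto simp: coboundary_eq)
    qed
    \<comment> \<open>The zero cochain is written as a multiple of \<open>w\<close>, whose color is
      0.\<close>
    then have "color w (coboundary (\<lambda>t. if t = s then 1 else 0)) u = color w (\<lambda>q. 0 * w q) u"
      by (intro color_cong[OF u]) simp
    then show ?thesis using False by (simp only: color_scale color_self if_False vector_smult_rzero)
  qed
qed

text \<open>Adding a multiple of \<open>w\<close> shifts all ratios to \<open>w\<close> by the same
  constant, so their differences depend on the color alone. The sign is the parity of the positions
  of the two omitted vertices.\<close>

lemma pairing_functional_row_color:
  assumes u: "card u = 5" "u \<subseteq> S" and \<phi>: "closed3 u \<phi>" and bc: "b \<in> u" "c \<in> u" "b < c"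
  shows "pairing (triangle_functional_row \<omega> (sorted_list_of_set u) (u - {b, c})) (color w \<phi> u) =
    (- 1) ^ (card {x \<in> u. x < b} + card {x \<in> u. x < c}) *
      (\<phi> (u - {c}) / w (u - {c}) - \<phi> (u - {b}) / w (u - {b}))"
proof -
  obtain i j k l m where u': "u = {i, j, k, l, m}" and less: "i < j" "j < k" "k < l" "l < m"
    using card_5_sorted[OF u(1)] .
  then have less': "i < k" "i < l" "i < m" "j < l" "j < m" "k < m" by simp_all
  note order = less less' less[THEN less_imp_neq] less'[THEN less_imp_neq]
    less[THEN less_imp_neq, symmetric] less'[THEN less_imp_neq, symmetric]
  have below: "{x \<in> u. x < i} = {}" "{x \<in> u. x < j} = {i}" "{x \<in> u. x < k} = {i, j}"
    "{x \<in> u. x < l} = {i, j, k}" "{x \<in> u. x < m} = {i, j, k, l}"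
    using less by (auto simp: u')
  have nz: "w {j, k, l, m} \<noteq> 0" "w {i, k, l, m} \<noteq> 0" "w {i, j, l, m} \<noteq> 0" "w {i, j, k, m} \<noteq> 0"
      "w {i, j, k, l} \<noteq> 0"
    using u u' less by (simp_all add: w_nonzero)
  \<comment> \<open>The facts \<open>nz\<close> run by increasing missing vertex, the letters
    \<open>A\<close> to \<open>E\<close> the other way round; hence the reversed order.\<close>
  note identities = pairing_identities[OF nz(5,4,3,2,1)
     closed3D[OF closed3_mono[OF w_closed u(2)], unfolded u', OF subset_refl less]
     closed3D[OF \<phi>, unfolded u', OF subset_refl less]]
  have "pairing (triangle_functional_row \<omega> [i, j, k, l, m] (u - {b, c})) (color w \<phi> u) =
    (- 1) ^ (card {x \<in> u. x < b} + card {x \<in> u. x < c}) *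
      (\<phi> (u - {c}) / w (u - {c}) - \<phi> (u - {b}) / w (u - {b}))"
    using bc unfolding u'
    \<comment> \<open>The slots \<open>q\<close> and \<open>q'\<close> stand for
      \<open>u - {b}\<close> and \<open>u - {c}\<close>, so every case becomes one of the ten
      identities.\<close>
    apply (rule triangle_complement_cases[OF less, where P = "\<lambda>b c s q q'.
          pairing (triangle_functional_row \<omega> [i, j, k, l, m] s) (color w \<phi> {i, j, k, l, m}) =
          (- 1) ^ (card {x \<in> {i, j, k, l, m}. x < b} + card {x \<in> {i, j, k, l, m}. x < c}) *
            (\<phi> q' / w q' - \<phi> q / w q)"])
                apply (simp_all only: below[unfolded u'])
              apply (simp_all only: order color_eq triangle_functional_row_def w_eq list.case Let_def
        sorted_triple_eq_iff simp_thms if_True if_False pairing_vector identities)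
    using less less' apply simp_all
    done
  then show ?thesis using less by (simp add: u' sorted_list_of_set_5)
qed

end

section \<open>Permitted colorings of a 5-simplex\<close>

lemma coboundary_add: "coboundary (\<lambda>t. a t + b t) = (\<lambda>q. coboundary a q + coboundary b q)"
  by (auto simp: coboundary_def fun_eq_iff split: list.split)

lemma coboundary_scale: "coboundary (\<lambda>t. c * a t) = (\<lambda>q. c * coboundary a q)"
  by (auto simp: coboundary_def fun_eq_iff algebra_simps split: list.split)

lemma coboundary_cong:
  assumes "card q = 4" "\<And>t. t \<subseteq> q \<Longrightarrow> card t = 3 \<Longrightarrow> a t = b t"
  shows "coboundary a q = coboundary b q"
proof -
  obtain i j k l where q: "q = {i, j, k, l}" "i < j" "j < k" "k < l"
    using card_4_sorted[OF assms(1)] .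
  have "a {j, k, l} = b {j, k, l}" "a {i, k, l} = b {i, k, l}" "a {i, j, l} = b {i, j, l}"
    "a {i, j, k} = b {i, j, k}"
    using q by (auto intro!: assms(2))
  then show ?thesis using q by (simp add: coboundary_eq)
qed

lemma closed3_cong:
  assumes "closed3 S \<phi>" "\<And>q. q \<subseteq> S \<Longrightarrow> card q = 4 \<Longrightarrow> \<phi> q = \<psi> q"
  shows "closed3 S \<psi>"
  unfolding closed3_def
proof (intro ballI impI)
  fix i j k l m
  assume S: "i \<in> S" "j \<in> S" "k \<in> S" "l \<in> S" "m \<in> S"
    and less: "i < j \<and> j < k \<and> k < l \<and> l < m"
  then have "\<psi> {j, k, l, m} = \<phi> {j, k, l, m}" "\<psi> {i, k, l, m} = \<phi> {i, k, l, m}"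
    "\<psi> {i, j, l, m} = \<phi> {i, j, l, m}" "\<psi> {i, j, k, m} = \<phi> {i, j, k, m}"
    "\<psi> {i, j, k, l} = \<phi> {i, j, k, l}"
    using assms(2)[of "{j, k, l, m}"] assms(2)[of "{i, k, l, m}"] assms(2)[of "{i, j, l, m}"]
      assms(2)[of "{i, j, k, m}"] assms(2)[of "{i, j, k, l}"] by simp_all
  then show "\<psi> {j, k, l, m} - \<psi> {i, k, l, m} + \<psi> {i, j, l, m} - \<psi> {i, j, k, m} + \<psi> {i, j, k, l} = 0"
    using closed3D[OF assms(1), of i j k l m] S less by simp
qed

text \<open>Any five vertices of a 6-element set form a facet, so each cocycle condition lives on
  one facet.\<close>

lemma closed3_facets:
  assumes "card v = 6" "\<And>u. u \<in> facets v \<Longrightarrow> closed3 u \<phi>"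
  shows "closed3 v \<phi>"
  unfolding closed3_def
proof (intro ballI impI)
  fix i j k l m
  assume v: "i \<in> v" "j \<in> v" "k \<in> v" "l \<in> v" "m \<in> v"
    and less: "i < j \<and> j < k \<and> k < l \<and> l < m"
  let ?u = "{i, j, k, l, m}"
  have "?u \<subseteq> v" "card ?u = 5" using v less by simp_all
  then have "card (v - ?u) = 1" using assms(1) by (simp add: card_Diff_subset)
  then obtain x where "v - ?u = {x}" by (rule card_1_singletonE)
  then have "?u = v - {x}" "x \<in> v" using \<open>?u \<subseteq> v\<close> by auto
  then have "closed3 ?u \<phi>" using assms(2) by (auto simp: facets_def)
  then show "\<phi> {j, k, l, m} - \<phi> {i, k, l, m} + \<phi> {i, j, l, m} - \<phi> {i, j, k, m} + \<phi> {i, j, k, l} = 0"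
    using less by (simp add: closed3_def)
qed

lemma facetE:
  assumes "u \<in> facets v" "card v = 6"
  shows "card u = 5" "u \<subseteq> v"
  using assms by (auto simp: facets_def card_Diff_singleton card_ge_0_finite)

lemma finite_facets: "finite v \<Longrightarrow> finite (facets v)"
  by (simp add: facets_def setcompr_eq_image)

text \<open>An additive 1-cocycle \<open>c\<close> on the index set is the coboundary of a function
  \<open>h\<close>; adding \<open>h a * w\<close> to the local cochains removes their jumps.\<close>

lemma glue_cochains:
  fixes T :: "'i \<Rightarrow> nat set" and \<phi> :: "'i \<Rightarrow> nat set \<Rightarrow> 'a::field"
  assumes diff: "\<And>a b q. a \<in> I \<Longrightarrow> b \<in> I \<Longrightarrow> q \<subseteq> T a \<Longrightarrow> q \<subseteq> T b \<Longrightarrow> card q = 4 \<Longrightarrow>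
      \<phi> a q - \<phi> b q = c a b * w q"
    and c: "\<And>a b d. a \<in> I \<Longrightarrow> b \<in> I \<Longrightarrow> d \<in> I \<Longrightarrow> c a b + c b d = c a d"
  obtains \<psi> h where "\<And>a q. a \<in> I \<Longrightarrow> q \<subseteq> T a \<Longrightarrow> card q = 4 \<Longrightarrow> \<psi> q = \<phi> a q + h a * w q"
proof (cases "I = {}")
  case True
  then show ?thesis using that by simp
next
  case False
  then obtain o' where o': "o' \<in> I" by auto
  \<comment> \<open>With the base index \<open>o'\<close> fixed, additivity of \<open>c\<close>
    gives \<open>h a - h b = c b a\<close>.\<close>
  define h where "h = c o'"
  \<comment> \<open>The choice of an index covering \<open>q\<close> is immaterial, since the
    corrected cochains agree on overlaps.\<close>
  define \<psi> where "\<psi> q = (let a = SOME a. a \<in> I \<and> q \<subseteq> T a in \<phi> a q + h a * w q)" for q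
  have "\<psi> q = \<phi> a q + h a * w q" if a: "a \<in> I" "q \<subseteq> T a" "card q = 4" for a q
  proof -
    define b where "b = (SOME a. a \<in> I \<and> q \<subseteq> T a)"
    have b: "b \<in> I" "q \<subseteq> T b"
      using someI[of "\<lambda>a. a \<in> I \<and> q \<subseteq> T a" a] a by (simp_all add: b_def)
    have "\<phi> b q - \<phi> a q = c b a * w q" using diff[of b a q] a b by simp
    moreover have "c o' b + c b a = c o' a" using c o' a b by blast
    ultimately have "\<phi> b q + c o' b * w q = \<phi> a q + c o' a * w q" by algebra
    then show ?thesis by (simp add: \<psi>_def Let_def b_def h_def)
  qed
  then show ?thesis using that by blast
qed

context generic_cocycle
begin

section \<open>V-colorings and F-colorings in terms of cocycles\<close>

lemma triangle_vector_eq: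
  assumes "\<And>u. u \<in> K \<Longrightarrow> card u = 5" "card s = 3"
  shows "triangle_vector \<omega> K s =
    restrict_coloring (color w (coboundary (\<lambda>t. if t = s then 1 else 0))) K"
proof
  fix u
  show "triangle_vector \<omega> K s u =
      restrict_coloring (color w (coboundary (\<lambda>t. if t = s then 1 else 0))) K u"
    using triangle_vector_row_eq_color[of u s] assms
    by (auto simp: triangle_vector_def restrict_coloring_def)
qed

text \<open>The color of a coboundary is linear in the 2-cochain, and triangle vectors are the
  images of the indicator functions of triangles, so they span the whole image.\<close>

lemma V_colorings_eq:
  assumes fin: "finite K" and card: "\<And>u. u \<in> K \<Longrightarrow> card u = 5"
  shows "V_colorings \<omega> K = range (\<lambda>a. restrict_coloring (color w (coboundary a)) K)"
    (is "_ = range ?L")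
proof
  have L_add: "?L (\<lambda>t. a t + b t) = ?L a + ?L b" for a b
    by (auto simp: coboundary_add color_add restrict_coloring_def fun_eq_iff)
  have L_scale: "?L (\<lambda>t. c * a t) = scale_coloring c (?L a)" for c a
    by (auto simp: coboundary_scale color_scale restrict_coloring_def scale_coloring_def fun_eq_iff)
  show "V_colorings \<omega> K \<subseteq> range ?L"
    unfolding V_colorings_def
  proof (rule coloring.span_minimal)
    show "triangle_vector \<omega> K ` triangles K \<subseteq> range ?L"
      using triangle_vector_eq[OF card] by (auto simp: triangles_def)
    have "0 = scale_coloring 0 (?L (\<lambda>_. 0))" by simp
    then have "0 \<in> range ?L" unfolding L_scale[symmetric] by blast
    moreover have "x + y \<in> range ?L" if x: "x \<in> range ?L" and y: "y \<in> range ?L" for x y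
    proof -
      obtain a b where "x = ?L a" "y = ?L b" using x y by auto
      then have "x + y = ?L (\<lambda>t. a t + b t)" using L_add by simp
      then show ?thesis by blast
    qed
    moreover have "scale_coloring c x \<in> range ?L" if x: "x \<in> range ?L" for c x
    proof -
      obtain a where "x = ?L a" using x by auto
      then have "scale_coloring c x = ?L (\<lambda>t. c * a t)" using L_scale by simp
      then show ?thesis by blast
    qed
    ultimately show "coloring.subspace (range ?L)" by (simp add: coloring.subspace_def)
  qed
  show "range ?L \<subseteq> V_colorings \<omega> K"
  proof
    fix x assume "x \<in> range ?L"
    then obtain a where a: "x = ?L a" by auto
    \<comment> \<open>Induction on a finite set of triangles expands a cochain supported there into
      indicator functions.\<close>
    have "?L (\<lambda>t. if t \<in> A then a t else 0) \<in> V_colorings \<omega> K" if "A \<subseteq> triangles K" "finite A" for A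
      using that(2,1)
    proof (induction A rule: finite_induct)
      case empty
      have "?L (\<lambda>t. if t \<in> {} then a t else 0) = scale_coloring 0 (?L a)"
        unfolding L_scale[symmetric] by simp
      also have "\<dots> = 0" by (rule coloring.scale_zero_left)
      finally show ?case unfolding V_colorings_def by (simp only: coloring.span_zero)
    next
      case (insert s A)
      have "(\<lambda>t. if t \<in> insert s A then a t else 0) =
          (\<lambda>t. a s * (if t = s then 1 else 0) + (if t \<in> A then a t else 0))"
        using insert.hyps by auto
      then have "?L (\<lambda>t. if t \<in> insert s A then a t else 0) =
          scale_coloring (a s) (triangle_vector \<omega> K s) + ?L (\<lambda>t. if t \<in> A then a t else 0)"
        using insert.prems triangle_vector_eq[where s = s, OF card]
        by (simp only: L_add L_scale) (simp add: triangles_def)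
      moreover have "?L (\<lambda>t. if t \<in> A then a t else 0) \<in> V_colorings \<omega> K"
        using insert by blast
      moreover have "triangle_vector \<omega> K s \<in> V_colorings \<omega> K"
        using insert.prems unfolding V_colorings_def by (intro coloring.span_base) blast
      ultimately show ?case
        unfolding V_colorings_def by (simp only: coloring.span_add coloring.span_scale)
    qed
    moreover have "triangles K \<subseteq> Pow (\<Union>K)" by (auto simp: triangles_def)
    then have "finite (triangles K)"
      by (rule finite_subset) (use fin card card_ge_0_finite in force)
    ultimately have "?L (\<lambda>t. if t \<in> triangles K then a t else 0) \<in> V_colorings \<omega> K" by blast
    \<comment> \<open>Colors on \<open>K\<close> see the values of \<open>a\<close> on triangles of
      \<open>K\<close> only.\<close>
    moreover have "?L (\<lambda>t. if t \<in> triangles K then a t else 0) = ?L a"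
    proof -
      have "color w (coboundary (\<lambda>t. if t \<in> triangles K then a t else 0)) u = color w (coboundary a) u"
        if "u \<in> K" for u
        using that by (intro color_cong card coboundary_cong) (simp_all add: triangles_def, blast)
      then show ?thesis by (auto simp: restrict_coloring_def fun_eq_iff)
    qed
    ultimately show "x \<in> V_colorings \<omega> K" by (simp add: a)
  qed
qed

text \<open>The cone over the smallest vertex makes every cocycle on a 5-simplex a coboundary. In
  terms of cocycles a coloring can be assembled from its facets.\<close>

lemma V_permitted_eq:
  assumes v: "card v = 6"
  shows "V_permitted \<omega> v = {restrict_coloring (color w \<phi>) (facets v) |\<phi>. closed3 v \<phi>}"
proof -
  have fin: "finite v" using v by (simp add: card_ge_0_finite)
  have "v \<noteq> {}" using v by auto
  have "V_permitted \<omega> v = range (\<lambda>a. restrict_coloring (color w (coboundary a)) (facets v))"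
    unfolding V_permitted_def using facetE[OF _ v] finite_facets[OF fin] by (intro V_colorings_eq) auto
  also have "\<dots> = {restrict_coloring (color w \<phi>) (facets v) |\<phi>. closed3 v \<phi>}"
  proof -
    have "restrict_coloring (color w \<phi>) (facets v) \<in>
        range (\<lambda>a. restrict_coloring (color w (coboundary a)) (facets v))" if \<phi>: "closed3 v \<phi>" for \<phi>
    proof -
      let ?a = "\<lambda>t. if Min v \<in> t then 0 else \<phi> (insert (Min v) t)"
      have "color w \<phi> u = color w (coboundary ?a) u" if "u \<in> facets v" for u
        using facetE[OF that v] closed3_eq_coboundary_Min[OF \<phi>, of "Min v"] fin \<open>v \<noteq> {}\<close>
        by (intro color_cong) auto
      then have "restrict_coloring (color w \<phi>) (facets v) =
          restrict_coloring (color w (coboundary ?a)) (facets v)"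
        by (auto simp: restrict_coloring_def fun_eq_iff)
      then show ?thesis by blast
    qed
    then show ?thesis using closed3_coboundary by blast
  qed
  finally show ?thesis .
qed

text \<open>Only the facets opposite \<open>a\<close>, \<open>b\<close> and \<open>c\<close> contain
  the triangle; each contributes a difference of two ratios. Incidence signs, together with the
  shifts of position caused by omitting a vertex, leave one common sign and a minus before the
  middle term.\<close>

lemma triangle_functional_color:
  assumes v: "card v = 6" "v \<subseteq> S" and abc: "a \<in> v" "b \<in> v" "c \<in> v" "a < b" "b < c"
    and closed: "\<And>a. a \<in> v \<Longrightarrow> closed3 (v - {a}) (\<phi> a)"
    and x: "\<And>a. a \<in> v \<Longrightarrow> x (v - {a}) = color w (\<phi> a) (v - {a})"
  defines "r \<equiv> \<lambda>a b. \<phi> a (v - {a} - {b}) / w (v - {a} - {b})"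
  shows "triangle_functional \<omega> (facets v) (boundary_sign v) (v - {a, b, c}) x =
    (- 1) ^ (card {y \<in> v. y < a} + card {y \<in> v. y < b} + card {y \<in> v. y < c}) *
      ((r a c - r a b) - (r b c - r b a) + (r c b - r c a))"
proof -
  have fin: "finite v" using v by (simp add: card_ge_0_finite)
  let ?n = "\<lambda>a. card {y \<in> v. y < a}"
  have sub: "v - {y} \<subseteq> S" "y \<in> v \<Longrightarrow> card (v - {y}) = 5" for y
    using v fin by (auto simp: card_Diff_singleton)
  have sign: "boundary_sign v (v - {y}) = (- 1) ^ ?n y" if "y \<in> v" for y
  proof -
    have "v - (v - {y}) = {y}" using that by auto
    then show ?thesis by (simp add: boundary_sign_def)
  qed
  have above: "{z \<in> v - {y}. z < y'} = {z \<in> v. z < y'} - {y}" for y y' by auto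
  have n: "card {z \<in> v - {y}. z < y'} = ?n y'" if "y' \<le> y" for y y'
    using that by (intro arg_cong[where f = card]) auto
  have n': "?n y' = Suc (card {z \<in> v - {y}. z < y'})" if "y < y'" "y \<in> v" for y y'
    unfolding above using that fin by (subst card.remove[of _ y]) auto
  have eq: "triangle_functional \<omega> (facets v) (boundary_sign v) (v - {a, b, c}) x =
      (\<Sum>u\<in>{v - {a}, v - {b}, v - {c}}. of_int (boundary_sign v u) *
         pairing (triangle_functional_row \<omega> (sorted_list_of_set u) (v - {a, b, c})) (x u))"
    unfolding triangle_functional_def using abc by (intro sum.cong) (auto simp: facets_def)
  let ?pairing = "\<lambda>u. pairing (triangle_functional_row \<omega> (sorted_list_of_set u) (v - {a, b, c})) (x u)"
  have pairing_eq: "?pairing (v - {y}) =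
      (- 1) ^ (card {z \<in> v - {y}. z < y1} + card {z \<in> v - {y}. z < y2}) * (r y y2 - r y y1)"
    if "y \<in> v" "y1 \<in> v - {y}" "y2 \<in> v - {y}" "y1 < y2" "{a, b, c} = {y, y1, y2}" for y y1 y2
  proof -
    have "v - {a, b, c} = v - {y} - {y1, y2}" unfolding that(5) by auto
    then show ?thesis
      using pairing_functional_row_color[OF sub(2)[OF that(1)] sub(1) closed[OF that(1)] that(2-4)]
      by (simp only: x[OF that(1)] r_def)
  qed
  have "v - {y} \<noteq> v - {z}" if "y \<in> v" "y < z" for y z
    using that by blast
  then have distinct: "v - {a} \<noteq> v - {b}" "v - {a} \<noteq> v - {c}" "v - {b} \<noteq> v - {c}"
    using abc less_trans[OF abc(4,5)] by blast+
  have sum3: "sum f {v - {a}, v - {b}, v - {c}} = f (v - {a}) + (f (v - {b}) + f (v - {c}))"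
    for f :: "nat set \<Rightarrow> 'a"
    using distinct by simp
  \<comment> \<open>\<open>nb\<close> and \<open>nc\<close> are one less than the positions of
    \<open>b\<close> and \<open>c\<close> in \<open>v\<close>, because a smaller vertex has been
    removed; all counts below are one of these numbers or a successor.\<close>
  define na nb nc
    where "na = ?n a" and "nb = card {z \<in> v - {a}. z < b}" and "nc = card {z \<in> v - {b}. z < c}"
  have below_a: "?n a = na" "card {z \<in> v - {b}. z < a} = na" "card {z \<in> v - {c}. z < a} = na"
    using abc n[of a b] n[of a c] by (simp_all only: na_def less_imp_le less_trans[of a b c])
  have below_b: "?n b = Suc nb" "card {z \<in> v - {a}. z < b} = nb" "card {z \<in> v - {c}. z < b} = Suc nb"
    using abc n[of b c] n'[of a b] by (simp_all only: nb_def less_imp_le)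
  have below_c: "?n c = Suc nc" "card {z \<in> v - {a}. z < c} = nc" "card {z \<in> v - {b}. z < c} = nc"
    using abc n'[of b c] n'[of a c] by (simp_all only: nc_def less_trans[of a b c] nat.inject)
  have pa: "?pairing (v - {a}) =
      (- 1) ^ (nb + nc) * (r a c - r a b)"
    using abc by (subst pairing_eq[of a b c]) (simp_all only: below_b below_c, auto)
  have pb: "?pairing (v - {b}) =
      (- 1) ^ (na + nc) * (r b c - r b a)"
    using abc by (subst pairing_eq[of b a c]) (simp_all only: below_a below_c, auto)
  have pc: "?pairing (v - {c}) =
      (- 1) ^ (na + Suc nb) * (r c b - r c a)"
    using abc by (subst pairing_eq[of c a b]) (simp_all only: below_a below_b, auto)
  show ?thesis
    unfolding eq sum3 pa pb pc sign[OF abc(1)] sign[OF abc(2)] sign[OF abc(3)] below_a below_b below_c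
    by (simp add: power_add algebra_simps)
qed

text \<open>For one inclusion, a single cocycle has equal ratios on a tetrahedron seen from both
  facets. For the other, the color of each facet is lifted to a cocycle and the lifts are
  glued.\<close>

lemma F_permitted_eq_V_permitted:
  assumes v: "card v = 6" "v \<subseteq> S"
  shows "F_permitted \<omega> v = V_permitted \<omega> v"
proof
  have fin: "finite v" using v by (simp add: card_ge_0_finite)
  show "V_permitted \<omega> v \<subseteq> F_permitted \<omega> v"
  proof
    fix x assume "x \<in> V_permitted \<omega> v"
    then obtain \<phi> where \<phi>: "closed3 v \<phi>" and x: "x = restrict_coloring (color w \<phi>) (facets v)"
      unfolding V_permitted_eq[OF v(1)] by auto
    have "triangle_functional \<omega> (facets v) (boundary_sign v) s x = 0" if "s \<in> triangles (facets v)" for s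
    proof -
      have s: "card s = 3" "s \<subseteq> v" using that by (auto simp: triangles_def facets_def)
      then have "card (v - s) = 3" using v fin by (simp add: card_Diff_subset finite_subset)
      then obtain a b c where abc: "v - s = {a, b, c}" "a < b" "b < c" by (rule card_3_sorted)
      then have "s = v - {a, b, c}" "a \<in> v" "b \<in> v" "c \<in> v" using s by auto
      \<comment> \<open>This makes the ratios symmetric in the two omitted vertices, so the six
        terms cancel in pairs.\<close>
      moreover have "v - {y} - {z} = v - {z} - {y}" for y z by auto
      ultimately show ?thesis
        using triangle_functional_color[OF v _ _ _ abc(2,3), of "\<lambda>_. \<phi>" x] closed3_mono[OF \<phi>]
        by (simp add: x restrict_coloring_def facets_def) (smt (verit) diff_self)
    qed
    then show "x \<in> F_permitted \<omega> v"
      by (auto simp: F_permitted_def F_colorings_def colorings_def x restrict_coloring_def)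
  qed
  show "F_permitted \<omega> v \<subseteq> V_permitted \<omega> v"
  proof
    fix x assume "x \<in> F_permitted \<omega> v"
    then have x: "x \<in> colorings (facets v)"
      "\<And>s. s \<in> triangles (facets v) \<Longrightarrow> triangle_functional \<omega> (facets v) (boundary_sign v) s x = 0"
      by (auto simp: F_permitted_def F_colorings_def)
    have sub: "v - {y} \<subseteq> S" "y \<in> v \<Longrightarrow> card (v - {y}) = 5" for y
      using v fin by (auto simp: card_Diff_singleton)
    have "\<forall>a. \<exists>\<phi>. a \<in> v \<longrightarrow> closed3 (v - {a}) \<phi> \<and> color w \<phi> (v - {a}) = x (v - {a})"
      using color_surj sub by metis
    then obtain \<phi> where \<phi>: "\<And>a. a \<in> v \<Longrightarrow> closed3 (v - {a}) (\<phi> a)"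
      "\<And>a. a \<in> v \<Longrightarrow> x (v - {a}) = color w (\<phi> a) (v - {a})"
      by metis
    define r where "r a b = \<phi> a (v - {a} - {b}) / w (v - {a} - {b})" for a b
    have cyc: "(r a c - r a b) - (r b c - r b a) + (r c b - r c a) = 0"
      if "a \<in> v" "b \<in> v" "c \<in> v" "a < b" "b < c" for a b c
    proof -
      have "card (v - {a, b, c}) = 3" using that v fin by (simp add: card_Diff_subset)
      moreover have "v - {a, b, c} \<subseteq> v - {a}" by auto
      ultimately have "v - {a, b, c} \<in> triangles (facets v)"
        using that by (auto simp: triangles_def facets_def)
      then have "(- 1) ^ (card {y \<in> v. y < a} + card {y \<in> v. y < b} + card {y \<in> v. y < c}) *
          ((r a c - r a b) - (r b c - r b a) + (r c b - r c a)) = 0"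
        using x(2) triangle_functional_color[OF v that \<phi>] unfolding r_def by simp
      then show ?thesis unfolding mult_eq_0_iff by simp
    qed
    \<comment> \<open>The jump between the facets opposite \<open>a\<close> and \<open>b\<close> on
      their common tetrahedron. An F-equation is the additive rule for these jumps at three
      increasing vertices.\<close>
    define c where "c a b = r a b - r b a" for a b
    have c: "c a b + c b d = c a d" if abd: "a \<in> v" "b \<in> v" "d \<in> v" for a b d
    proof -
      \<comment> \<open>Since \<open>c\<close> is antisymmetric, every order of the three vertices
        reduces to the increasing one.\<close>
      consider "a = b \<or> b = d \<or> a = d" | "a < b" "b < d" | "a < d" "d < b" | "b < a" "a < d"
        | "b < d" "d < a" | "d < a" "a < b" | "d < b" "b < a" by linarith
      then show ?thesis
      proof cases
        case 1 then show ?thesis by (auto simp: c_def)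
      next
        case 2 then show ?thesis unfolding c_def using cyc[OF abd(1,2,3) 2] by algebra
      next
        case 3 then show ?thesis unfolding c_def using cyc[OF abd(1,3,2) 3] by algebra
      next
        case 4 then show ?thesis unfolding c_def using cyc[OF abd(2,1,3) 4] by algebra
      next
        case 5 then show ?thesis unfolding c_def using cyc[OF abd(2,3,1) 5] by algebra
      next
        case 6 then show ?thesis unfolding c_def using cyc[OF abd(3,1,2) 6] by algebra
      next
        case 7 then show ?thesis unfolding c_def using cyc[OF abd(3,2,1) 7] by algebra
      qed
    qed
    \<comment> \<open>Two distinct facets share a single tetrahedron, and there the claim is the
      definition of \<open>c\<close> with the denominator \<open>w q\<close> cleared.\<close>
    have diff: "\<phi> a q - \<phi> b q = c a b * w q"
      if ab: "a \<in> v" "b \<in> v" and q: "q \<subseteq> v - {a}" "q \<subseteq> v - {b}" "card q = 4" for a b q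
    proof (cases "a = b")
      case True then show ?thesis by (simp add: c_def)
    next
      case False
      have "card (v - {a} - {b}) = 4" using sub(2)[OF ab(1)] ab(2) False fin by (simp add: card_Diff_singleton)
      then have "q = v - {a} - {b}"
        using q fin by (intro card_subset_eq) auto
      moreover have "v - {b} - {a} = v - {a} - {b}" by auto
      moreover have "w q \<noteq> 0" using q v by (intro w_nonzero) auto
      ultimately show ?thesis by (simp add: c_def r_def field_simps)
    qed
    obtain \<psi> h where \<psi>: "\<And>a q. a \<in> v \<Longrightarrow> q \<subseteq> v - {a} \<Longrightarrow> card q = 4 \<Longrightarrow> \<psi> q = \<phi> a q + h a * w q"
      using glue_cochains[of v "\<lambda>a. v - {a}" \<phi> c w] diff c by metis
    have "closed3 v \<psi>"
    proof (rule closed3_facets[OF v(1)])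
      fix u assume "u \<in> facets v"
      then obtain a where a: "a \<in> v" "u = v - {a}" by (auto simp: facets_def)
      show "closed3 u \<psi>"
        unfolding a(2) using \<psi>[OF a(1)]
        by (intro closed3_cong[OF closed3_add[OF \<phi>(1)[OF a(1)]
          closed3_scale[OF closed3_mono[OF w_closed sub(1)]], of "h a"]]) simp
    qed
    moreover have "x u = restrict_coloring (color w \<psi>) (facets v) u" for u
    proof (cases "u \<in> facets v")
      case True
      then obtain a where a: "a \<in> v" "u = v - {a}" by (auto simp: facets_def)
      have "color w \<psi> u = color w (\<lambda>q. \<phi> a q + h a * w q) u"
        unfolding a(2) using \<psi>[OF a(1)] by (intro color_cong sub a) simp
      also have "\<dots> = x u" by (simp add: color_add color_scale color_self a \<phi>(2))
      finally show ?thesis using True by (simp add: restrict_coloring_def)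
    next
      case False
      then show ?thesis using x(1) by (simp add: colorings_def restrict_coloring_def)
    qed
    ultimately show "x \<in> V_permitted \<omega> v" unfolding V_permitted_eq[OF v(1)] by blast
  qed
qed

end

section \<open>Clusters\<close>

lemma restrict_coloring_restrict_coloring:
  "L \<subseteq> K \<Longrightarrow> restrict_coloring (restrict_coloring x K) L = restrict_coloring x L"
  by (auto simp: restrict_coloring_def fun_eq_iff)

lemma cluster_boundary_subset: "cluster_boundary M \<subseteq> cluster_simplices4 M"
  by (auto simp: cluster_boundary_def cluster_simplices4_def)

text \<open>For distinct \<open>a\<close> and \<open>b\<close> in \<open>S\<close>, the set
  \<open>S - {a, b}\<close> is a facet of \<open>S - {a}\<close> and \<open>S - {b}\<close> only. It
  is on the boundary when exactly one of these is in the cluster.\<close>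

lemma cluster_boundary_facets:
  assumes "A \<subseteq> S"
  shows "cluster_boundary ((\<lambda>a. S - {a}) ` A) = {S - {a, b} |a b. a \<in> A \<and> b \<in> S - A}"
proof (intro set_eqI iffI)
  fix u assume "u \<in> cluster_boundary ((\<lambda>a. S - {a}) ` A)"
  then obtain a where a: "a \<in> A" "u \<in> facets (S - {a})"
    and unique: "\<And>a'. a' \<in> A \<Longrightarrow> u \<in> facets (S - {a'}) \<Longrightarrow> S - {a'} = S - {a}"
    by (auto simp: cluster_boundary_def)
  from a(2) obtain b where b: "b \<in> S" "b \<noteq> a" "u = S - {a} - {b}" by (auto simp: facets_def)
  have "b \<notin> A"
  proof
    assume "b \<in> A"
    moreover have "u = S - {b} - {a}" "a \<in> S - {b}" using a b assms by auto
    then have "u \<in> facets (S - {b})" by (auto simp: facets_def)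
    ultimately have "S - {b} = S - {a}" by (rule unique)
    then show False using b a assms by auto
  qed
  moreover have "u = S - {a, b}" using b by auto
  ultimately show "u \<in> {S - {a, b} |a b. a \<in> A \<and> b \<in> S - A}" using a b by blast
next
  fix u assume "u \<in> {S - {a, b} |a b. a \<in> A \<and> b \<in> S - A}"
  then obtain a b where ab: "a \<in> A" "b \<in> S" "b \<notin> A" "u = S - {a, b}" by auto
  have "u = S - {a} - {b}" "b \<in> S - {a}" using ab by auto
  then have u: "u \<in> facets (S - {a})" by (auto simp: facets_def)
  have "a' = a" if a': "a' \<in> A" "u \<in> facets (S - {a'})" for a'
  proof -
    have "a' \<notin> u" using a' by (auto simp: facets_def)
    then show ?thesis using a' ab assms by auto
  qed
  then show "u \<in> cluster_boundary ((\<lambda>a. S - {a}) ` A)"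
    unfolding cluster_boundary_def using u ab(1) by blast
qed

text \<open>The description of the boundary is symmetric under exchanging \<open>A\<close> and its
  complement.\<close>

lemma cluster_boundary_complement:
  assumes "A \<subseteq> S"
  shows "cluster_boundary ((\<lambda>a. S - {a}) ` A) = cluster_boundary ((\<lambda>a. S - {a}) ` (S - A))"
proof -
  have "S - {a, b} = S - {b, a}" for a b by auto
  moreover have "S - (S - A) = A" using assms by auto
  ultimately show ?thesis
    using cluster_boundary_facets[OF assms] cluster_boundary_facets[of "S - A" S] by simp blast
qed

text \<open>\<open>p\<close> is a vertex of every 5-simplex of the cluster and serves as cone apex.
  The resulting set depends on the cluster only through its boundary, which is what allows two
  clusters to be compared.\<close>

lemma (in generic_cocycle) permitted_boundary_colorings_eq:
  assumes S: "card S = 7" and A: "A \<subseteq> S" and p: "p \<in> S - A"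
    and extremal: "(\<forall>x\<in>S. p \<le> x) \<or> (\<forall>x\<in>S. x \<le> p)"
  defines "M \<equiv> (\<lambda>a. S - {a}) ` A"
  shows "permitted_boundary_colorings (V_permitted \<omega>) M =
    range (\<lambda>a. restrict_coloring (color w (coboundary a)) (cluster_boundary M))"
proof -
  have fin: "finite S" using S by (simp add: card_ge_0_finite)
  have card: "card (S - {a}) = 6" if "a \<in> A" for a
    using that S A by (simp add: card_Diff_singleton subset_iff)
  have facets_M: "facets (S - {a}) \<subseteq> cluster_simplices4 M" if "a \<in> A" for a
    using that by (auto simp: cluster_simplices4_def M_def)
  have "restrict_coloring (color w (coboundary a)) (cluster_boundary M)
      \<in> permitted_boundary_colorings (V_permitted \<omega>) M" for a
  proof -
    let ?x = "restrict_coloring (color w (coboundary a)) (cluster_simplices4 M)"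
    have "restrict_coloring ?x (facets v) \<in> V_permitted \<omega> v" if v: "v \<in> M" for v
    proof -
      obtain b where b: "b \<in> A" "v = S - {b}" using v by (auto simp: M_def)
      show ?thesis
        unfolding b(2) V_permitted_eq[OF card[OF b(1)]]
          restrict_coloring_restrict_coloring[OF facets_M[OF b(1)]]
        using closed3_coboundary by blast
    qed
    then have "?x \<in> permitted_colorings (V_permitted \<omega>) M"
      by (auto simp: permitted_colorings_def colorings_def restrict_coloring_def)
    then show ?thesis
      unfolding permitted_boundary_colorings_def
      using restrict_coloring_restrict_coloring[OF cluster_boundary_subset] by (metis imageI)
  qed
  moreover have "restrict_coloring x (cluster_boundary M) \<in>
      range (\<lambda>a. restrict_coloring (color w (coboundary a)) (cluster_boundary M))"
    if x: "x \<in> permitted_colorings (V_permitted \<omega>) M" for x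
  proof -
    have "\<forall>a. \<exists>\<phi>. a \<in> A \<longrightarrow> closed3 (S - {a}) \<phi> \<and>
        restrict_coloring x (facets (S - {a})) = restrict_coloring (color w \<phi>) (facets (S - {a}))"
      using x V_permitted_eq[OF card] by (fastforce simp: permitted_colorings_def M_def)
    then obtain \<phi> where \<phi>: "\<And>a. a \<in> A \<Longrightarrow> closed3 (S - {a}) (\<phi> a)"
      and eq: "\<And>a. a \<in> A \<Longrightarrow>
        restrict_coloring x (facets (S - {a})) = restrict_coloring (color w (\<phi> a)) (facets (S - {a}))"
      by metis
    have x_eq: "x u = color w (\<phi> a) u" if "a \<in> A" "u \<in> facets (S - {a})" for a u
      using fun_cong[OF eq[OF that(1)], of u] that(2) by (simp add: restrict_coloring_def)
    \<comment> \<open>Two 5-simplices share a 4-simplex; equal colors there make the two cocycles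
      agree up to a multiple of \<open>w\<close>.\<close>
    have "\<exists>c. \<forall>q. q \<subseteq> S - {a} \<and> q \<subseteq> S - {b} \<and> card q = 4 \<longrightarrow> \<phi> a q - \<phi> b q = c * w q"
      if ab: "a \<in> A" "b \<in> A" for a b
    proof (cases "a = b")
      case True
      then show ?thesis by (intro exI[of _ 0]) simp
    next
      case False
      let ?u = "S - {a} - {b}"
      have u: "?u \<in> facets (S - {a})" "?u \<in> facets (S - {b})"
        using ab A False by (auto simp: facets_def)
      have "closed3 ?u (\<phi> a)" "closed3 ?u (\<phi> b)"
        by (rule closed3_mono[OF \<phi>[OF ab(1)]], blast) (rule closed3_mono[OF \<phi>[OF ab(2)]], blast)
      moreover have "color w (\<phi> a) ?u = color w (\<phi> b) ?u"
        using x_eq[OF ab(1) u(1)] x_eq[OF ab(2) u(2)] by simp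
      ultimately obtain c where c: "\<And>q. q \<subseteq> ?u \<Longrightarrow> card q = 4 \<Longrightarrow> \<phi> a q - \<phi> b q = c * w q"
        using color_eq_iff[of ?u "\<phi> a" "\<phi> b"] facetE[OF u(1) card[OF ab(1)]] by blast
      then show ?thesis by (intro exI[of _ c] allI impI c) auto
    qed
    then obtain c where c: "\<And>a b q. a \<in> A \<Longrightarrow> b \<in> A \<Longrightarrow> q \<subseteq> S - {a} \<Longrightarrow> q \<subseteq> S - {b} \<Longrightarrow>
        card q = 4 \<Longrightarrow> \<phi> a q - \<phi> b q = c a b * w q"
      by metis
    \<comment> \<open>Three 5-simplices still share at least 7 - 3 = 4 vertices. On a common
      tetrahedron the three differences add up, and \<open>w\<close> is nonzero there.\<close>
    have c_trans: "c a b + c b d = c a d" if abd: "a \<in> A" "b \<in> A" "d \<in> A" for a b d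
    proof -
      have "card {a, b, d} \<le> 3" by (simp add: card_insert_if)
      moreover have "card S - card {a, b, d} \<le> card (S - {a, b, d})" by (intro diff_card_le_card_Diff) simp
      ultimately have "4 \<le> card (S - {a, b, d})" using S by simp
      then obtain q where q: "q \<subseteq> S - {a, b, d}" "card q = 4" by (rule obtain_subset_with_card_n)
      then have "q \<subseteq> S - {a}" "q \<subseteq> S - {b}" "q \<subseteq> S - {d}" "w q \<noteq> 0" using w_nonzero by auto
      moreover from this have "(c a b + c b d) * w q = c a d * w q"
        using c[of a b q] c[of b d q] c[of a d q] abd q by (simp add: distrib_right flip: c)
      ultimately show ?thesis by simp
    qed
    obtain \<psi> h where \<psi>: "\<And>a q. a \<in> A \<Longrightarrow> q \<subseteq> S - {a} \<Longrightarrow> card q = 4 \<Longrightarrow> \<psi> q = \<phi> a q + h a * w q"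
      using glue_cochains[of A "\<lambda>a. S - {a}" \<phi> c w] c c_trans by metis
    have closed: "closed3 (S - {a}) \<psi>" if "a \<in> A" for a
      using \<psi>[OF that] by (intro closed3_cong[OF closed3_add[OF \<phi>[OF that]
          closed3_scale[OF closed3_mono[OF w_closed Diff_subset]], of "h a"]]) simp
    \<comment> \<open>The cone formula with apex \<open>p\<close> does not mention \<open>a\<close>,
      so one \<open>e\<close> serves all 5-simplices, although \<open>\<psi>\<close> is known to be
      closed only on each of them separately.\<close>
    obtain e where e: "\<And>a q. a \<in> A \<Longrightarrow> q \<subseteq> S - {a} \<Longrightarrow> card q = 4 \<Longrightarrow> \<psi> q = coboundary e q"
    proof (cases "\<forall>x\<in>S. p \<le> x")
      case True
      show thesis
      proof (rule that)
        fix a q assume "a \<in> A" "q \<subseteq> S - {a}" "card q = 4"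
        then show "\<psi> q = coboundary (\<lambda>t. if p \<in> t then 0 else \<psi> (insert p t)) q"
          using True p by (intro closed3_eq_coboundary_Min[OF closed]) auto
      qed
    next
      case False
      show thesis
      proof (rule that)
        fix a q assume "a \<in> A" "q \<subseteq> S - {a}" "card q = 4"
        then show "\<psi> q = coboundary (\<lambda>t. if p \<in> t then 0 else - \<psi> (insert p t)) q"
          using False extremal p by (intro closed3_eq_coboundary_Max[OF closed]) auto
      qed
    qed
    have "x u = color w (coboundary e) u" if u: "u \<in> cluster_simplices4 M" for u
    proof -
      obtain a where a: "a \<in> A" "u \<in> facets (S - {a})"
        using u by (auto simp: cluster_simplices4_def M_def)
      note u = facetE[OF a(2) card[OF a(1)]]
      have "color w (coboundary e) u = color w (\<lambda>q. \<phi> a q + h a * w q) u"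
        using u \<psi>[OF a(1)] e[OF a(1)] by (intro color_cong) auto
      also have "\<dots> = x u" using x_eq[OF a] by (simp add: color_add color_scale color_self)
      finally show ?thesis by simp
    qed
    then have "restrict_coloring x (cluster_boundary M) =
        restrict_coloring (color w (coboundary e)) (cluster_boundary M)"
      using cluster_boundary_subset[of M] by (auto simp: restrict_coloring_def fun_eq_iff)
    then show ?thesis by blast
  qed
  ultimately show ?thesis unfolding permitted_boundary_colorings_def by blast
qed

lemma permitted_boundary_colorings_cong:
  assumes "\<And>v. v \<in> M \<Longrightarrow> P v = Q v"
  shows "permitted_boundary_colorings P M = permitted_boundary_colorings Q M"
  using assms by (simp add: permitted_boundary_colorings_def permitted_colorings_def)

theorem theorem11:
  fixes \<omega> :: "'a::field cochain3"
  assumes "cocycle3 {1..7} \<omega>"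
    and "generic3 {1..7} \<omega>"
  shows "cluster_boundary pachner34_left = cluster_boundary pachner34_right \<and>
    permitted_boundary_colorings (V_permitted \<omega>) pachner34_left =
      permitted_boundary_colorings (V_permitted \<omega>) pachner34_right \<and>
    permitted_boundary_colorings (F_permitted \<omega>) pachner34_left =
      permitted_boundary_colorings (F_permitted \<omega>) pachner34_right"
proof -
  let ?S = "{1..7::nat}"
  interpret generic_cocycle ?S \<omega> "on_tetrahedra \<omega>"
    using assms by unfold_locales
  have S: "?S = {1, 2, 3, 4, 5, 6, 7}" by auto
  \<comment> \<open>Clusters are indexed by the omitted vertices, in the order in which their
    5-simplices are listed.\<close>
  have left: "pachner34_left = (\<lambda>a. ?S - {a}) ` {7, 6, 5}"
    unfolding pachner34_left_def S by (simp add: insert_Diff_if)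
  have right: "pachner34_right = (\<lambda>a. ?S - {a}) ` {4, 3, 2, 1}"
    unfolding pachner34_right_def S by (simp add: insert_Diff_if)
  have "{4, 3, 2, 1} = ?S - {7, 6, 5}" unfolding S by auto
  then have boundary: "cluster_boundary pachner34_left = cluster_boundary pachner34_right"
    unfolding left right by (simp only:) (rule cluster_boundary_complement, simp)
  \<comment> \<open>The apex is 1 on the left and 7 on the right; both sides are then the same
    range, as the boundaries agree.\<close>
  have V: "permitted_boundary_colorings (V_permitted \<omega>) pachner34_left =
      permitted_boundary_colorings (V_permitted \<omega>) pachner34_right"
    using permitted_boundary_colorings_eq[of "{7, 6, 5}" 1]
      permitted_boundary_colorings_eq[of "{4, 3, 2, 1}" 7] boundary
    unfolding left[symmetric] right[symmetric] by simp
  have F: "F_permitted \<omega> v = V_permitted \<omega> v" if "v \<in> pachner34_left \<union> pachner34_right" for v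
    using that unfolding left right by (intro F_permitted_eq_V_permitted) auto
  have "permitted_boundary_colorings (F_permitted \<omega>) M = permitted_boundary_colorings (V_permitted \<omega>) M"
    if "M = pachner34_left \<or> M = pachner34_right" for M
    using that F by (intro permitted_boundary_colorings_cong) auto
  then show ?thesis using boundary V by simp
qed

end
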